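(* Let $d\ge1$, let $\Delta$ be a $d$-dimensional orientable pseudomanifold with (nonempty) boundary and $s=f_d(\Delta)$ facets, let $G=(V,E)$ be its facet-ridge graph, and let $A\subseteq V$ be the set of vertices of $G$ corresponding to facets of $\Delta$ that contain a free ridge. Then (1) $\mathcal{P}_\Delta$ is unimodularly equivalent to an $s$-dimensional crosspolytope, and (2) $\mathcal{P}^\Delta$ is unimodularly equivalent to $\pi_V(\mathcal{P}_{w(G,A)})$, where $\pi_V$ is the projection onto the coordinates corresponding to $V$.
   Context: For $j\ge1$ the boundary map $\partial_j$ of a simplicial complex on $[n]$ sends $\{i_1<\dots<i_{j+1}\}$ to $\sum_k(-1)^{k+1}(\sigma\setminus\{i_k\})$, identified with its integer matrix. For $d=\dim\Delta$: $\mathcal{P}_\Delta=\operatorname{conv}$ of the columns of $\pm\partial_d$; $\mathcal{P}^\Delta=\operatorname{conv}$ of the columns of $\pm\partial_d^\top$. For a graph $H$, $\mathcal{P}_H=\operatorname{conv}$ of the columns of $\pm$ its directed incidence matrix, a polytope in $\mathbb{R}^{V(H)}$. A $d$-pseudomanifold is a pure complex where each $(d-1)$-face (ridge) lies in at most two facets, strongly connected via ridges. A ridge in exactly one facet is free; the boundary $\partial\Delta$ is the complex generated by the free ridges, and $\Delta$ has boundary if $\partial\Delta\neq\emptyset$. It is orientable if the relative homology $H_d(\Delta,\partial\Delta;\mathbb{Z})$ (homology of the quotient chain complex $C_\bullet(\Delta)/C_\bullet(\partial\Delta)$) is $\cong\mathbb{Z}$. The facet-ridge graph has the facets as vertices,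 adjacent iff they share a ridge. The whiskering $w(G,A)$ is obtained from $G$ by adding, for each vertex in $A$, a new leaf adjacent to it. An $s$-dimensional crosspolytope is a polytope combinatorially equivalent to $\operatorname{conv}(\pm\mathbf{e}_1,\dots,\pm\mathbf{e}_s)$. Polytopes are unimodularly equivalent if, after possibly adding coordinates, one is the image of the other under an integer matrix of determinant $\pm1$. *)

theory Defs
  imports
    "HOL-Analysis.Polytope"
    "HOL-Analysis.Finite_Function_Topology"
    "HOL-Algebra.Free_Abelian_Groups"
    "HOL-Algebra.Elementary_Groups"
    "Jordan_Normal_Form.Determinant"
begin

section \<open>Simplicial complexes\<close>

definition abstract_simplicial_complex :: "nat \<Rightarrow> nat set set \<Rightarrow> bool" where
  "abstract_simplicial_complex n \<Delta> \<longleftrightarrow>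
     \<Delta> \<subseteq> Pow {1..n} \<and> \<Delta> \<noteq> {} \<and> (\<forall>\<sigma>\<in>\<Delta>. \<forall>\<tau>. \<tau> \<subseteq> \<sigma> \<longrightarrow> \<tau> \<in> \<Delta>)"

definition faces :: "nat \<Rightarrow> nat set set \<Rightarrow> nat set set" where
  "faces j \<Delta> = {\<sigma> \<in> \<Delta>. card \<sigma> = j + 1}"

definition complex_dim :: "nat set set \<Rightarrow> int" where
  "complex_dim \<Delta> = int (Max (card ` \<Delta>)) - 1"

definition facets :: "nat set set \<Rightarrow> nat set set" where
  "facets \<Delta> = {\<sigma> \<in> \<Delta>. \<forall>\<tau>\<in>\<Delta>. \<sigma> \<subseteq> \<tau> \<longrightarrow> \<tau> = \<sigma>}"

text \<open>The \<open>k\<close>-th smallest vertex \<open>i\<close> of \<open>\<sigma>\<close> (counting from 1) has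
  \<open>k = card {l \<in> \<sigma>. l \<le> i}\<close>.\<close>

definition simplex_boundary :: "nat set \<Rightarrow> (nat set \<Rightarrow>\<^sub>0 int)" where
  "simplex_boundary \<sigma> =
     (\<Sum>i\<in>\<sigma>. frag_cmul ((-1) ^ (card {l \<in> \<sigma>. l \<le> i} + 1)) (frag_of (\<sigma> - {i})))"

text \<open>The chain complex is not augmented: the boundary of a 0-chain is 0.\<close>

definition chain_bd :: "nat \<Rightarrow> (nat set \<Rightarrow>\<^sub>0 int) \<Rightarrow> (nat set \<Rightarrow>\<^sub>0 int)" where
  "chain_bd j c = (if j = 0 then 0 else frag_extend simplex_boundary c)"

definition bd_matrix :: "nat set \<Rightarrow> nat set \<Rightarrow> int" where
  "bd_matrix \<tau> \<sigma> = Poly_Mapping.lookup (simplex_boundary \<sigma>) \<tau>"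


section \<open>Relative homology of a pair of complexes\<close>

definition simp_chain_group :: "nat \<Rightarrow> nat set set \<Rightarrow> (nat set \<Rightarrow>\<^sub>0 int) monoid" where
  "simp_chain_group j \<Delta> = free_Abelian_group (faces j \<Delta>)"

definition rel_chain_group ::
    "nat \<Rightarrow> nat set set \<Rightarrow> nat set set \<Rightarrow> (nat set \<Rightarrow>\<^sub>0 int) set monoid" where
  "rel_chain_group j \<Delta> \<Gamma> = simp_chain_group j \<Delta> Mod carrier (simp_chain_group j \<Gamma>)"

text \<open>The induced map on cosets: \<open>c + C\<^sub>j(\<Gamma>)\<close> is sent to
  \<open>chain_bd j c + C\<^sub>j\<^sub>-\<^sub>1(\<Gamma>)\<close>.  For \<open>j = 0\<close> this is the zero map.\<close>

definition rel_bd ::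
    "nat \<Rightarrow> nat set set \<Rightarrow> nat set set \<Rightarrow> (nat set \<Rightarrow>\<^sub>0 int) set \<Rightarrow> (nat set \<Rightarrow>\<^sub>0 int) set" where
  "rel_bd j \<Delta> \<Gamma> X =
     (chain_bd j ` X) <#>\<^bsub>simp_chain_group (j - 1) \<Delta>\<^esub> carrier (simp_chain_group (j - 1) \<Gamma>)"

definition rel_homology ::
    "nat \<Rightarrow> nat set set \<Rightarrow> nat set set \<Rightarrow> (nat set \<Rightarrow>\<^sub>0 int) set set monoid" where
  "rel_homology j \<Delta> \<Gamma> =
     (rel_chain_group j \<Delta> \<Gamma>
        \<lparr>carrier := kernel (rel_chain_group j \<Delta> \<Gamma>) (rel_chain_group (j - 1) \<Delta> \<Gamma>) (rel_bd j \<Delta> \<Gamma>)\<rparr>)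
     Mod (rel_bd (j + 1) \<Delta> \<Gamma> ` carrier (rel_chain_group (j + 1) \<Delta> \<Gamma>))"


section \<open>Pseudomanifolds\<close>

definition ridge_adjacent :: "nat \<Rightarrow> nat set set \<Rightarrow> nat set \<Rightarrow> nat set \<Rightarrow> bool" where
  "ridge_adjacent d \<Delta> \<sigma> \<tau> \<longleftrightarrow>
     \<sigma> \<in> facets \<Delta> \<and> \<tau> \<in> facets \<Delta> \<and> \<sigma> \<noteq> \<tau> \<and> (\<exists>\<rho>\<in>faces (d - 1) \<Delta>. \<rho> \<subseteq> \<sigma> \<and> \<rho> \<subseteq> \<tau>)"

definition pseudomanifold :: "nat \<Rightarrow> nat set set \<Rightarrow> bool" where
  "pseudomanifold d \<Delta> \<longleftrightarrow>
     complex_dim \<Delta> = int d \<and>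
     (\<forall>\<sigma>\<in>facets \<Delta>. card \<sigma> = d + 1) \<and>
     (\<forall>\<rho>\<in>faces (d - 1) \<Delta>. card {\<sigma> \<in> facets \<Delta>. \<rho> \<subseteq> \<sigma>} \<le> 2) \<and>
     (\<forall>\<sigma>\<in>facets \<Delta>. \<forall>\<tau>\<in>facets \<Delta>. (ridge_adjacent d \<Delta>)\<^sup>*\<^sup>* \<sigma> \<tau>)"

definition free_ridges :: "nat \<Rightarrow> nat set set \<Rightarrow> nat set set" where
  "free_ridges d \<Delta> = {\<rho> \<in> faces (d - 1) \<Delta>. card {\<sigma> \<in> facets \<Delta>. \<rho> \<subseteq> \<sigma>} = 1}"

definition boundary_complex :: "nat \<Rightarrow> nat set set \<Rightarrow> nat set set" where
  "boundary_complex d \<Delta> = {\<tau>. \<exists>\<rho>\<in>free_ridges d \<Delta>. \<tau> \<subseteq> \<rho>}"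

definition orientable :: "nat \<Rightarrow> nat set set \<Rightarrow> bool" where
  "orientable d \<Delta> \<longleftrightarrow> rel_homology d \<Delta> (boundary_complex d \<Delta>) \<cong> integer_group"


section \<open>Graphs\<close>

text \<open>A graph is a pair of a vertex set and a set of two-element edges.\<close>

type_synonym 'v ugraph = "'v set \<times> 'v set set"

abbreviation gverts :: "'v ugraph \<Rightarrow> 'v set" where "gverts \<equiv> fst"
abbreviation gedges :: "'v ugraph \<Rightarrow> 'v set set" where "gedges \<equiv> snd"

definition facet_ridge_graph :: "nat \<Rightarrow> nat set set \<Rightarrow> nat set ugraph" where
  "facet_ridge_graph d \<Delta> = (facets \<Delta>, {{\<sigma>, \<tau>} | \<sigma> \<tau>. ridge_adjacent d \<Delta> \<sigma> \<tau>})"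

text \<open>The original vertex \<open>v\<close> is \<open>Inl v\<close>; the leaf attached to \<open>a\<close> is \<open>Inr a\<close>.\<close>

definition whiskering :: "'v ugraph \<Rightarrow> 'v set \<Rightarrow> ('v + 'v) ugraph" where
  "whiskering G A =
     (Inl ` gverts G \<union> Inr ` A, (\<lambda>e. Inl ` e) ` gedges G \<union> {{Inl a, Inr a} | a. a \<in> A})"

definition orientation_of :: "'v ugraph \<Rightarrow> ('v \<times> 'v) set \<Rightarrow> bool" where
  "orientation_of H D \<longleftrightarrow> bij_betw (\<lambda>(u, v). {u, v}) D (gedges H)"

definition incidence_matrix :: "'v \<Rightarrow> 'v \<times> 'v \<Rightarrow> int" where
  "incidence_matrix w a = (if w = snd a then 1 else 0) - (if w = fst a then 1 else 0)"


section \<open>Polytopes\<close>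

text \<open>For a finite index set \<open>I\<close>, the space of real vectors indexed by \<open>I\<close> is
  represented by the finitely supported functions whose support lies in \<open>I\<close>.\<close>

definition coord_space :: "'i set \<Rightarrow> ('i \<Rightarrow>\<^sub>0 real) set" where
  "coord_space I = {x. Poly_Mapping.keys x \<subseteq> I}"

definition matrix_column :: "'r set \<Rightarrow> ('r \<Rightarrow> 'c \<Rightarrow> int) \<Rightarrow> 'c \<Rightarrow> ('r \<Rightarrow>\<^sub>0 real)" where
  "matrix_column R M c = (\<Sum>r\<in>R. Poly_Mapping.single r (real_of_int (M r c)))"

text \<open>Convex hull of the columns of \<open>M\<close> and \<open>-M\<close>, where \<open>M\<close> has rows \<open>R\<close> and columns \<open>C\<close>.\<close>

definition sym_polytope :: "'r set \<Rightarrow> 'c set \<Rightarrow> ('r \<Rightarrow> 'c \<Rightarrow> int) \<Rightarrow> ('r \<Rightarrow>\<^sub>0 real) set" where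
  "sym_polytope R C M =
     convex hull (matrix_column R M ` C \<union> matrix_column R (\<lambda>r c. - M r c) ` C)"

text \<open>The polytopes of the columns and of the rows of the top boundary matrix.\<close>

definition complex_polytope :: "nat \<Rightarrow> nat set set \<Rightarrow> (nat set \<Rightarrow>\<^sub>0 real) set" where
  "complex_polytope d \<Delta> = sym_polytope (faces (d - 1) \<Delta>) (faces d \<Delta>) bd_matrix"

definition complex_copolytope :: "nat \<Rightarrow> nat set set \<Rightarrow> (nat set \<Rightarrow>\<^sub>0 real) set" where
  "complex_copolytope d \<Delta> =
     sym_polytope (faces d \<Delta>) (faces (d - 1) \<Delta>) (\<lambda>\<sigma> \<tau>. bd_matrix \<tau> \<sigma>)"

text \<open>The directed incidence matrix is taken with respect to an orientation \<open>D\<close> of the edges;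
  the resulting polytope does not depend on \<open>D\<close>.\<close>

definition graph_polytope :: "'v ugraph \<Rightarrow> ('v \<times> 'v) set \<Rightarrow> ('v \<Rightarrow>\<^sub>0 real) set" where
  "graph_polytope H D = sym_polytope (gverts H) D incidence_matrix"

definition coord_projection :: "'i set \<Rightarrow> ('i \<Rightarrow>\<^sub>0 real) \<Rightarrow> ('i \<Rightarrow>\<^sub>0 real)" where
  "coord_projection W x = (\<Sum>w\<in>W. Poly_Mapping.single w (Poly_Mapping.lookup x w))"

definition combinatorially_equivalent :: "'a::real_vector set \<Rightarrow> 'b::real_vector set \<Rightarrow> bool" where
  "combinatorially_equivalent P Q \<longleftrightarrow>
     (\<exists>f. bij_betw f {F. F face_of P} {F. F face_of Q} \<and>
          (\<forall>F F'. F face_of P \<longrightarrow> F' face_of P \<longrightarrow> (f F \<subseteq> f F' \<longleftrightarrow> F \<subseteq> F')))"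

definition standard_crosspolytope :: "nat \<Rightarrow> (nat \<Rightarrow>\<^sub>0 real) set" where
  "standard_crosspolytope s =
     convex hull (\<Union>i\<in>{1..s}. {Poly_Mapping.single i 1, - Poly_Mapping.single i 1})"

definition is_crosspolytope :: "nat \<Rightarrow> 'a::real_vector set \<Rightarrow> bool" where
  "is_crosspolytope s Q \<longleftrightarrow>
     polytope Q \<and> combinatorially_equivalent Q (standard_crosspolytope s)"

text \<open>For an injective map \<open>\<alpha>\<close> from \<open>I\<close> into \<open>{..<N}\<close>, coordinate \<open>i\<close> becomes coordinate
  \<open>\<alpha> i\<close> and all the added coordinates are 0.\<close>

definition embed_coords :: "nat \<Rightarrow> 'i set \<Rightarrow> ('i \<Rightarrow> nat) \<Rightarrow> ('i \<Rightarrow>\<^sub>0 real) \<Rightarrow> real Matrix.vec" where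
  "embed_coords N I \<alpha> x =
     Matrix.vec N (\<lambda>k. \<Sum>i\<in>I. if \<alpha> i = k then Poly_Mapping.lookup x i else 0)"

definition unimodularly_equivalent ::
    "'i set \<Rightarrow> ('i \<Rightarrow>\<^sub>0 real) set \<Rightarrow> 'j set \<Rightarrow> ('j \<Rightarrow>\<^sub>0 real) set \<Rightarrow> bool" where
  "unimodularly_equivalent I P J Q \<longleftrightarrow>
     P \<subseteq> coord_space I \<and> Q \<subseteq> coord_space J \<and>
     (\<exists>N \<alpha> \<beta>. \<exists>U :: int mat.
        inj_on \<alpha> I \<and> \<alpha> ` I \<subseteq> {..<N} \<and> inj_on \<beta> J \<and> \<beta> ` J \<subseteq> {..<N} \<and>
        U \<in> carrier_mat N N \<and> Determinant.det U \<in> {1, -1} \<and>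
        (\<lambda>v. map_mat real_of_int U *\<^sub>v v) ` (embed_coords N I \<alpha> ` P) = embed_coords N J \<beta> ` Q)"

end

(*
  The absolute value of the coefficients of a chain is constant on facets as soon as its boundary
  vanishes on all ridges lying in two facets, by strong connectivity. If the boundary vanishes on a
  free ridge too, the chain is zero, so the columns of the top boundary matrix are linearly
  independent and P_Delta is an injective linear image of the standard crosspolytope. A nonzero
  relative cycle, provided by orientability, has nonzero coefficients of constant absolute value;
  multiplying the coordinates by their signs is a unimodular map that turns the row of a ridge
  shared by sigma and tau into +-(e_sigma - e_tau) and that of a free ridge in sigma into
  +-e_sigma. These are the columns of the whiskered graph after the projection.
*)
theory Submission
  imports Defs
begin

section \<open>Finitely supported vectors\<close>

text \<open>Scaling is defined by abstracting a function, so evaluating it requires finite support;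
  the support of \<open>x\<close> bounds that of the scaled function.\<close>

lemma lookup_scaleR [simp]:
  fixes x :: "'i \<Rightarrow>\<^sub>0 'a::real_vector"
  shows "Poly_Mapping.lookup (r *\<^sub>R x) i = r *\<^sub>R Poly_Mapping.lookup x i"
proof -
  have "{i. r *\<^sub>R Poly_Mapping.lookup x i \<noteq> 0} \<subseteq> Poly_Mapping.keys x"
    by (rule subsetI, rule ccontr) (simp add: not_in_keys_iff_lookup_eq_zero)
  then have "finite {i. r *\<^sub>R Poly_Mapping.lookup x i \<noteq> 0}"
    by (rule finite_subset) simp
  then show ?thesis
    by (simp add: scaleR_poly_mapping_def)
qed

lemma lookup_sum_single:
  assumes "finite I"
  shows "Poly_Mapping.lookup (\<Sum>i\<in>I. Poly_Mapping.single i (f i)) k = (if k \<in> I then f k else 0)"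
  using assms by (simp add: lookup_sum lookup_single when_def)

lemma lookup_matrix_column:
  "finite R \<Longrightarrow>
   Poly_Mapping.lookup (matrix_column R M c) r = (if r \<in> R then real_of_int (M r c) else 0)"
  unfolding matrix_column_def by (rule lookup_sum_single)

lemma matrix_column_uminus: "matrix_column R (\<lambda>r c. - M r c) c = - matrix_column R M c"
  unfolding matrix_column_def by (simp add: single_uminus sum_negf)

text \<open>With the generators grouped into antipodal pairs, two such polytopes can be compared by
  matching their columns up to sign.\<close>

lemma sym_polytope_alt:
  "sym_polytope R C M = convex hull (\<Union>c\<in>C. {matrix_column R M c, - matrix_column R M c})"
  unfolding sym_polytope_def matrix_column_uminus by (rule arg_cong[of _ _ "(hull) convex"]) auto

lemma linear_image_sym_polytope:
  assumes "linear f"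
  shows "f ` sym_polytope R C M =
    convex hull (\<Union>c\<in>C. {f (matrix_column R M c), - f (matrix_column R M c)})"
  unfolding sym_polytope_alt convex_hull_linear_image[OF assms]
  by (simp add: image_UN linear_neg[OF assms])

lemma polytope_image:
  "linear f \<Longrightarrow> polytope P \<Longrightarrow> polytope (f ` P)"
  unfolding polytope_def by (metis convex_hull_linear_image finite_imageI)

lemma coord_space_iff: "x \<in> coord_space I \<longleftrightarrow> (\<forall>i. i \<notin> I \<longrightarrow> Poly_Mapping.lookup x i = 0)"
  unfolding coord_space_def mem_Collect_eq by (metis in_keys_iff subset_iff)

lemma subspace_coord_space: "subspace (coord_space I)"
  by (simp add: subspace_def coord_space_iff lookup_add)

lemma sym_polytope_subset_coord_space:
  assumes "finite R"
  shows "sym_polytope R C M \<subseteq> coord_space R"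
  unfolding sym_polytope_alt
proof (rule hull_minimal)
  have "matrix_column R M c \<in> coord_space R" for c
    using assms by (simp add: coord_space_iff lookup_matrix_column)
  then show "(\<Union>c\<in>C. {matrix_column R M c, - matrix_column R M c}) \<subseteq> coord_space R"
    using subspace_neg[OF subspace_coord_space] by blast
qed (use subspace_coord_space subspace_imp_convex in blast)


section \<open>Signed relabellings of coordinates\<close>

text \<open>One construction covers the three coordinate changes used below: numbering the ridges,
  flipping the signs of the facet coordinates, and, with \<open>\<gamma>\<close> the identity on a
  subset, projecting onto that subset.\<close>

definition coord_map :: "'i set \<Rightarrow> ('i \<Rightarrow> 'j) \<Rightarrow> ('i \<Rightarrow> real) \<Rightarrow> ('i \<Rightarrow>\<^sub>0 real) \<Rightarrow> ('j \<Rightarrow>\<^sub>0 real)"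
  where "coord_map I \<gamma> \<epsilon> x = (\<Sum>i\<in>I. Poly_Mapping.single (\<gamma> i) (\<epsilon> i * Poly_Mapping.lookup x i))"

lemma lookup_coord_map:
  assumes "finite I" "inj_on \<gamma> I" "i \<in> I"
  shows "Poly_Mapping.lookup (coord_map I \<gamma> \<epsilon> x) (\<gamma> i) = \<epsilon> i * Poly_Mapping.lookup x i"
proof -
  have "Poly_Mapping.lookup (coord_map I \<gamma> \<epsilon> x) (\<gamma> i) =
      (\<Sum>j\<in>I. if j = i then \<epsilon> j * Poly_Mapping.lookup x j else 0)"
    unfolding coord_map_def lookup_sum lookup_single when_def
    using assms by (intro sum.cong) (auto simp: inj_on_def)
  also have "\<dots> = \<epsilon> i * Poly_Mapping.lookup x i"
    using assms by simp
  finally show ?thesis .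
qed

lemma lookup_coord_map_notin:
  "k \<notin> \<gamma> ` I \<Longrightarrow> Poly_Mapping.lookup (coord_map I \<gamma> \<epsilon> x) k = 0"
  unfolding coord_map_def lookup_sum lookup_single when_def by (intro sum.neutral) auto

lemma linear_coord_map: "linear (coord_map I \<gamma> \<epsilon>)"
  by (rule linearI; rule poly_mapping_eqI)
    (auto simp: coord_map_def lookup_sum lookup_add lookup_single when_def algebra_simps
      sum_distrib_left simp flip: sum.distrib intro!: sum.cong)

lemma inj_on_coord_map:
  assumes "finite I" "inj_on \<gamma> I" "\<And>i. i \<in> I \<Longrightarrow> \<epsilon> i \<noteq> 0"
  shows "inj_on (coord_map I \<gamma> \<epsilon>) (coord_space I)"
proof (rule inj_onI, rule poly_mapping_eqI)
  fix x y i
  assume xy: "x \<in> coord_space I" "y \<in> coord_space I" "coord_map I \<gamma> \<epsilon> x = coord_map I \<gamma> \<epsilon> y"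
  show "Poly_Mapping.lookup x i = Poly_Mapping.lookup y i"
  proof (cases "i \<in> I")
    case True
    then show ?thesis
      using lookup_coord_map[OF assms(1,2) True, of \<epsilon>] xy(3) assms(3)[OF True]
      by (metis mult_left_cancel)
  next
    case False
    then show ?thesis
      using xy(1,2) by (simp add: coord_space_iff)
  qed
qed

section \<open>Signed relabellings as unimodular matrices\<close>

lemma embed_coords_nth:
  assumes "finite I" "inj_on \<alpha> I" "\<alpha> ` I \<subseteq> {..<N}" "i \<in> I"
  shows "vec_index (embed_coords N I \<alpha> x) (\<alpha> i) = Poly_Mapping.lookup x i"
proof -
  have "vec_index (embed_coords N I \<alpha> x) (\<alpha> i) =
      (\<Sum>j\<in>I. if \<alpha> j = \<alpha> i then Poly_Mapping.lookup x j else 0)"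
    unfolding embed_coords_def using assms by (subst index_vec) auto
  also have "\<dots> = (\<Sum>j\<in>I. if j = i then Poly_Mapping.lookup x j else 0)"
    using assms by (intro sum.cong) (auto simp: inj_on_def)
  also have "\<dots> = Poly_Mapping.lookup x i"
    using assms by simp
  finally show ?thesis .
qed

lemma prod_list_pm_one: "set xs \<subseteq> {1, - 1 :: int} \<Longrightarrow> prod_list xs \<in> {1, - 1}"
  by (induction xs) auto

text \<open>Once both coordinate sets are numbered compatibly, the relabelling becomes invisible and
  the map is multiplication by a diagonal matrix of signs.\<close>

lemma unimodularly_equivalent_coord_map:
  assumes I: "finite I" and \<gamma>: "bij_betw \<gamma> I J"
    and \<epsilon>: "\<And>i. i \<in> I \<Longrightarrow> \<epsilon> i \<in> {1, - 1}"
    and P: "P \<subseteq> coord_space I"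
  shows "unimodularly_equivalent I P J (coord_map I \<gamma> \<epsilon> ` P)"
proof -
  \<comment> \<open>No coordinate has to be added, since \<open>\<gamma>\<close> is a bijection
    between the two index sets.\<close>
  define N where "N = card I"
  obtain \<alpha> where "bij_betw \<alpha> I {0..<N}"
    using ex_bij_betw_finite_nat[OF I] N_def by blast
  then have inj\<alpha>: "inj_on \<alpha> I" and im\<alpha>: "\<alpha> ` I = {..<N}"
    by (auto simp: bij_betw_def)
  have inj\<gamma>: "inj_on \<gamma> I" and im\<gamma>: "\<gamma> ` I = J"
    using \<gamma> by (auto simp: bij_betw_def)
  \<comment> \<open>\<open>\<beta>\<close> gives \<open>\<gamma> i\<close> the number that
    \<open>\<alpha>\<close> gives \<open>i\<close>, so that only the signs remain after the
    embedding.\<close>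
  define \<beta> where "\<beta> = \<alpha> \<circ> inv_into I \<gamma>"
  have \<beta>\<gamma>: "\<beta> (\<gamma> i) = \<alpha> i" if "i \<in> I" for i
    using that inj\<gamma> by (simp add: \<beta>_def)
  have inj\<beta>: "inj_on \<beta> J"
    using inj\<alpha> inj\<gamma> im\<gamma> \<beta>\<gamma> by (auto simp: inj_on_def)
  have im\<beta>: "\<beta> ` J = {..<N}"
    unfolding im\<gamma>[symmetric] im\<alpha>[symmetric] image_image using \<beta>\<gamma> by simp
  \<comment> \<open>The signs are real and indexed by \<open>I\<close>; \<open>U\<close> needs them
    as integers indexed by positions.\<close>
  define e :: "nat \<Rightarrow> int" where "e k = (if \<epsilon> (inv_into I \<alpha> k) = 1 then 1 else - 1)" for k
  have e\<alpha>: "real_of_int (e (\<alpha> i)) = \<epsilon> i" if "i \<in> I" for i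
    using \<epsilon>[OF that] that inj\<alpha> by (auto simp: e_def)
  define U :: "int mat" where "U = Matrix.mat N N (\<lambda>(i, j). if i = j then e i else 0)"
  have U: "U \<in> carrier_mat N N"
    by (simp add: U_def)
  \<comment> \<open>A diagonal matrix is upper triangular, so its determinant is the product of the
    signs.\<close>
  have "Determinant.det U = prod_list (diag_mat U)"
    by (rule det_upper_triangular[OF _ U]) (auto simp: U_def)
  moreover have "set (diag_mat U) \<subseteq> {1, - 1}"
    by (auto simp: diag_mat_def U_def e_def)
  ultimately have det: "Determinant.det U \<in> {1, - 1}"
    using prod_list_pm_one by metis
  have "map_mat real_of_int U *\<^sub>v embed_coords N I \<alpha> x = embed_coords N J \<beta> (coord_map I \<gamma> \<epsilon> x)"
    for x
  proof (rule eq_vecI)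
    show "dim_vec (map_mat real_of_int U *\<^sub>v embed_coords N I \<alpha> x) =
        dim_vec (embed_coords N J \<beta> (coord_map I \<gamma> \<epsilon> x))"
      by (simp add: U_def embed_coords_def)
  next
    fix k
    assume "k < dim_vec (embed_coords N J \<beta> (coord_map I \<gamma> \<epsilon> x))"
    then have k: "k < N"
      by (simp add: embed_coords_def)
    then obtain i where i: "i \<in> I" "k = \<alpha> i"
      using im\<alpha> by blast
    have "vec_index (map_mat real_of_int U *\<^sub>v embed_coords N I \<alpha> x) k =
        (\<Sum>j = 0..<N. (if k = j then real_of_int (e k) else 0) * vec_index (embed_coords N I \<alpha> x) j)"
      using k by (auto simp: U_def scalar_prod_def embed_coords_def intro!: sum.cong)
    also have "\<dots> = (\<Sum>j = 0..<N.
        if j = k then real_of_int (e k) * vec_index (embed_coords N I \<alpha> x) j else 0)"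
      by (intro sum.cong) auto
    also have "\<dots> = real_of_int (e k) * vec_index (embed_coords N I \<alpha> x) k"
      using k by simp
    also have "\<dots> = \<epsilon> i * Poly_Mapping.lookup x i"
      using embed_coords_nth[OF I inj\<alpha> _ i(1), of N x] im\<alpha> i e\<alpha> by simp
    also have "\<dots> = Poly_Mapping.lookup (coord_map I \<gamma> \<epsilon> x) (\<gamma> i)"
      using lookup_coord_map[OF I inj\<gamma> i(1)] by simp
    also have "\<dots> = vec_index (embed_coords N J \<beta> (coord_map I \<gamma> \<epsilon> x)) (\<beta> (\<gamma> i))"
      using embed_coords_nth[OF _ inj\<beta>, of N "\<gamma> i"] im\<beta> im\<gamma> I i(1) by auto
    finally show "vec_index (map_mat real_of_int U *\<^sub>v embed_coords N I \<alpha> x) k =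
        vec_index (embed_coords N J \<beta> (coord_map I \<gamma> \<epsilon> x)) k"
      using \<beta>\<gamma> i by simp
  qed
  then have "(\<lambda>v. map_mat real_of_int U *\<^sub>v v) ` (embed_coords N I \<alpha> ` P) =
      embed_coords N J \<beta> ` (coord_map I \<gamma> \<epsilon> ` P)"
    by (simp add: image_image)
  moreover have "coord_map I \<gamma> \<epsilon> ` P \<subseteq> coord_space J"
    using lookup_coord_map_notin[of _ \<gamma> I \<epsilon>] im\<gamma> by (auto simp: coord_space_iff)
  ultimately show ?thesis
    unfolding unimodularly_equivalent_def
    by (intro conjI exI[of _ N] exI[of _ \<alpha>] exI[of _ \<beta>] exI[of _ U])
      (use P inj\<alpha> im\<alpha> inj\<beta> im\<beta> U det in simp_all)
qed


section \<open>Injective linear images and combinatorial equivalence\<close>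

text \<open>Faces are characterised by open segments. Since \<open>P\<close> is convex, a segment
  with ends in \<open>P\<close> stays in the region where \<open>f\<close> is injective, so
  \<open>f\<close> reflects membership in segments as well as preserving it, and it reflects
  convexity of subsets of \<open>P\<close> for the same reason.\<close>

lemma face_of_linear_image_iff:
  assumes f: "linear f" "inj_on f P" and P: "convex P" and "F \<subseteq> P"
  shows "f ` F face_of f ` P \<longleftrightarrow> F face_of P"
proof -
  have seg: "f x \<in> open_segment (f a) (f b) \<longleftrightarrow> x \<in> open_segment a b"
    if "a \<in> P" "b \<in> P" "x \<in> P" for a b x
  proof -
    have eq: "f ((1 - u) *\<^sub>R a + u *\<^sub>R b) = (1 - u) *\<^sub>R f a + u *\<^sub>R f b" for u
      using f by (simp add: linear_add linear_cmul)
    have mem: "(1 - u) *\<^sub>R a + u *\<^sub>R b \<in> P" if "0 < u" "u < 1" for u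
      using that P \<open>a \<in> P\<close> \<open>b \<in> P\<close> by (simp add: convexD_alt)
    \<comment> \<open>An open segment with equal ends is empty, so distinctness of the ends must be
      transferred too.\<close>
    have "f a \<noteq> f b \<longleftrightarrow> a \<noteq> b"
      using f that by (auto dest: inj_onD)
    moreover have "f x = (1 - u) *\<^sub>R f a + u *\<^sub>R f b \<longleftrightarrow> x = (1 - u) *\<^sub>R a + u *\<^sub>R b"
      if "0 < u" "u < 1" for u
      using eq mem[OF that] f \<open>x \<in> P\<close> by (metis inj_onD)
    ultimately show ?thesis
      unfolding in_segment by metis
  qed
  have "convex F" if "convex (f ` F)"
  proof (rule convexI)
    fix x y :: 'a and u v :: real
    assume *: "x \<in> F" "y \<in> F" "0 \<le> u" "0 \<le> v" "u + v = 1"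
    have "f (u *\<^sub>R x + v *\<^sub>R y) \<in> f ` F"
      using convexD[OF that, of "f x" "f y" u v] * f by (simp add: linear_add linear_cmul)
    moreover have "u *\<^sub>R x + v *\<^sub>R y \<in> P"
      using * \<open>F \<subseteq> P\<close> convexD[OF P] by blast
    ultimately show "u *\<^sub>R x + v *\<^sub>R y \<in> F"
      using f(2) \<open>F \<subseteq> P\<close> by (metis inj_on_image_mem_iff)
  qed
  then have cvx: "convex (f ` F) \<longleftrightarrow> convex F"
    using convex_linear_image[OF f(1)] by blast
  have mem: "f a \<in> f ` F \<longleftrightarrow> a \<in> F" if "a \<in> P" for a
    using inj_on_image_mem_iff[OF f(2) that \<open>F \<subseteq> P\<close>] .
  have seg': "f x \<in> open_segment (f a) (f b) \<longleftrightarrow> x \<in> open_segment a b"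
    if "a \<in> P" "b \<in> P" "x \<in> F" for a b x
    using seg that \<open>F \<subseteq> P\<close> by blast
  have "(\<forall>a\<in>P. \<forall>b\<in>P. \<forall>x\<in>F. f x \<in> open_segment (f a) (f b) \<longrightarrow> f a \<in> f ` F \<and> f b \<in> f ` F) \<longleftrightarrow>
      (\<forall>a\<in>P. \<forall>b\<in>P. \<forall>x\<in>F. x \<in> open_segment a b \<longrightarrow> a \<in> F \<and> b \<in> F)"
    by (intro ball_cong refl) (simp only: seg' mem)
  then show ?thesis
    unfolding face_of_def ball_simps cvx using \<open>F \<subseteq> P\<close> by (simp add: image_mono)
qed

text \<open>Every face of the image is the image of a face of \<open>P\<close>, and on subsets of
  \<open>P\<close> taking images preserves and reflects inclusion. The inverse of this
  correspondence is the required bijection, because the image stands on the left.\<close>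

lemma combinatorially_equivalent_linear_image:
  assumes f: "linear f" "inj_on f P" and P: "convex P"
  shows "combinatorially_equivalent (f ` P) P"
proof -
  let ?g = "\<lambda>F. inv_into P f ` F"
  have faces: "{F. F face_of f ` P} = (`) f ` {F. F face_of P}"
  proof (intro equalityI subsetI)
    fix F assume "F \<in> {F. F face_of f ` P}"
    then have F: "F face_of f ` P" by simp
    then obtain F' where "F' \<subseteq> P" "F = f ` F'"
      using face_of_imp_subset subset_imageE by metis
    then show "F \<in> (`) f ` {F. F face_of P}"
      using F face_of_linear_image_iff[OF f P] by blast
  qed (use face_of_linear_image_iff[OF f P] face_of_imp_subset in blast)
  have inv: "?g (f ` F) = F" if "F face_of P" for F
    using inv_into_image_cancel[OF f(2) face_of_imp_subset[OF that]] .
  have "bij_betw ?g {F. F face_of f ` P} {F. F face_of P}"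
    unfolding faces by (intro bij_betw_byWitness[where f' = "(`) f"]) (auto simp: inv)
  moreover have "?g F \<subseteq> ?g F' \<longleftrightarrow> F \<subseteq> F'" if "F face_of f ` P" "F' face_of f ` P" for F F'
  proof -
    have "F \<in> (`) f ` {F. F face_of P}" "F' \<in> (`) f ` {F. F face_of P}"
      using that unfolding faces[symmetric] by simp_all
    then obtain H H' where H: "F = f ` H" "F' = f ` H'" "H face_of P" "H' face_of P"
      by (elim imageE) simp
    then have "?g F = H" "?g F' = H'"
      using inv by simp_all
    then show ?thesis
      using H(1,2) by (metis image_mono)
  qed
  ultimately show ?thesis
    unfolding combinatorially_equivalent_def by blast
qed

text \<open>The ambient type has infinitely many coordinates, and the map used later kills all of
  them outside \<open>{1..s}\<close>; injectivity is therefore asked on the coordinate subspace that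
  contains the standard crosspolytope.\<close>

lemma is_crosspolytope_linear_image:
  assumes "linear f" "inj_on f (coord_space {1..s})"
  shows "is_crosspolytope s (f ` standard_crosspolytope s)"
proof -
  have "standard_crosspolytope s \<subseteq> coord_space {1..s}"
    unfolding standard_crosspolytope_def
    by (rule hull_minimal)
      (auto simp: coord_space_iff lookup_single when_def
        intro: subspace_imp_convex subspace_coord_space)
  moreover have "convex (standard_crosspolytope s)"
    by (simp add: standard_crosspolytope_def)
  moreover have "polytope (standard_crosspolytope s)"
    unfolding polytope_def standard_crosspolytope_def
    by (rule exI[of _ "\<Union>i\<in>{1..s}. {Poly_Mapping.single i 1, - Poly_Mapping.single i 1}"]) simp
  ultimately show ?thesis
    unfolding is_crosspolytope_def
    using assms polytope_image combinatorially_equivalent_linear_image inj_on_subset by blast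
qed


section \<open>Pseudomanifolds\<close>

lemma bd_matrix_eq:
  "finite \<sigma> \<Longrightarrow> bd_matrix \<tau> \<sigma> =
    (\<Sum>i\<in>\<sigma>. if \<sigma> - {i} = \<tau> then (-1) ^ (card {l \<in> \<sigma>. l \<le> i} + 1) else 0)"
  unfolding bd_matrix_def simplex_boundary_def lookup_sum
  by (intro sum.cong) auto

lemma bd_matrix_not_subset: "\<not> \<tau> \<subseteq> \<sigma> \<Longrightarrow> bd_matrix \<tau> \<sigma> = 0"
  \<comment> \<open>For an infinite simplex the defining sum is 0 by convention.\<close>
  by (cases "finite \<sigma>") (auto simp: bd_matrix_eq intro!: sum.neutral, simp add: bd_matrix_def simplex_boundary_def)

text \<open>Exactly one vertex can be deleted from \<open>\<sigma>\<close> to leave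
  \<open>\<tau>\<close>, so a single sign survives in the sum.\<close>

lemma bd_matrix_subset:
  assumes "finite \<sigma>" "\<tau> \<subseteq> \<sigma>" "card \<sigma> = card \<tau> + 1"
  shows "bd_matrix \<tau> \<sigma> \<in> {1, - 1}"
proof -
  have "card (\<sigma> - \<tau>) = 1"
    using assms by (simp add: card_Diff_subset finite_subset)
  then obtain i where "\<sigma> - \<tau> = {i}"
    by (auto simp: card_1_singleton_iff)
  then have i: "i \<in> \<sigma>" "\<And>j. j \<in> \<sigma> \<Longrightarrow> \<sigma> - {j} = \<tau> \<longleftrightarrow> j = i"
    using assms(2) by auto
  have "bd_matrix \<tau> \<sigma> =
      (\<Sum>j\<in>\<sigma>. if j = i then (-1) ^ (card {l \<in> \<sigma>. l \<le> j} + 1) else 0)"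
    unfolding bd_matrix_eq[OF assms(1)] using i by (intro sum.cong) auto
  also have "\<dots> = (-1) ^ (card {l \<in> \<sigma>. l \<le> i} + 1)"
    using i(1) assms(1) by simp
  finally show ?thesis
    by (metis insert_iff minus_one_power_iff)
qed

locale pseudomanifold_complex =
  fixes n d :: nat and \<Delta> :: "nat set set"
  assumes dim_pos: "d \<ge> 1"
    and complex: "abstract_simplicial_complex n \<Delta>"
    and pseudomanifold: "pseudomanifold d \<Delta>"
begin

lemma finite_complex: "finite \<Delta>"
  using complex unfolding abstract_simplicial_complex_def
  by (meson finite_Pow_iff finite_atLeastAtMost finite_subset)

lemma finite_face: "\<sigma> \<in> \<Delta> \<Longrightarrow> finite \<sigma>"
  using complex unfolding abstract_simplicial_complex_def
  by (meson Pow_iff finite_atLeastAtMost finite_subset subsetD)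

lemma finite_faces [simp]: "finite (faces j \<Delta>)"
  using finite_complex by (simp add: faces_def)

text \<open>Purity gives one inclusion. For the other, no face has more than \<open>d + 1\<close>
  vertices, so a face with that many is maximal. This links the matrices, indexed by faces, with the
  pseudomanifold axioms, stated for facets.\<close>

lemma facets_eq_faces: "facets \<Delta> = faces d \<Delta>"
proof
  show "facets \<Delta> \<subseteq> faces d \<Delta>"
    using pseudomanifold by (auto simp: pseudomanifold_def facets_def faces_def)
  have "int (Max (card ` \<Delta>)) = int d + 1"
    using pseudomanifold by (simp add: pseudomanifold_def complex_dim_def)
  then have le: "card \<tau> \<le> d + 1" if "\<tau> \<in> \<Delta>" for \<tau>
  proof -
    have "card \<tau> \<le> Max (card ` \<Delta>)"
      using finite_complex that by (intro Max_ge) simp_all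
    also have "\<dots> = d + 1"
      using \<open>int (Max (card ` \<Delta>)) = int d + 1\<close> by linarith
    finally show ?thesis .
  qed
  show "faces d \<Delta> \<subseteq> facets \<Delta>"
  proof
    fix \<sigma> assume "\<sigma> \<in> faces d \<Delta>"
    then have \<sigma>: "\<sigma> \<in> \<Delta>" "card \<sigma> = d + 1"
      by (simp_all add: faces_def)
    have "\<tau> = \<sigma>" if "\<tau> \<in> \<Delta>" "\<sigma> \<subseteq> \<tau>" for \<tau>
      using card_seteq[OF finite_face[OF that(1)] that(2)] le[OF that(1)] \<sigma>(2) by simp
    then show "\<sigma> \<in> facets \<Delta>"
      using \<sigma>(1) by (simp add: facets_def)
  qed
qed

lemma finite_facets [simp]: "finite (facets \<Delta>)"
  by (simp add: facets_eq_faces)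

section \<open>Ridges and the facets containing them\<close>

definition cofacets :: "nat set \<Rightarrow> nat set set" where
  "cofacets \<rho> = {\<sigma> \<in> facets \<Delta>. \<rho> \<subseteq> \<sigma>}"

lemma bd_matrix_cofacet:
  assumes "\<rho> \<in> faces (d - 1) \<Delta>" "\<sigma> \<in> cofacets \<rho>"
  shows "bd_matrix \<rho> \<sigma> \<in> {1, - 1}"
  using assms dim_pos
  by (intro bd_matrix_subset) (auto simp: cofacets_def facets_eq_faces faces_def intro: finite_face)

lemma bd_matrix_noncofacet: "\<sigma> \<in> facets \<Delta> \<Longrightarrow> \<sigma> \<notin> cofacets \<rho> \<Longrightarrow> bd_matrix \<rho> \<sigma> = 0"
  by (simp add: bd_matrix_not_subset cofacets_def)

lemma cofacets_free:
  assumes "\<rho> \<in> free_ridges d \<Delta>" "\<sigma> \<in> facets \<Delta>" "\<rho> \<subseteq> \<sigma>"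
  shows "cofacets \<rho> = {\<sigma>}"
proof -
  obtain \<tau> where "cofacets \<rho> = {\<tau>}"
    using assms(1) by (auto simp: free_ridges_def card_1_singleton_iff simp flip: cofacets_def)
  moreover have "\<sigma> \<in> cofacets \<rho>"
    using assms by (simp add: cofacets_def)
  ultimately show ?thesis
    by simp
qed

lemma free_ridge_cofacet:
  assumes "\<rho> \<in> free_ridges d \<Delta>"
  obtains \<sigma> where "\<sigma> \<in> facets \<Delta>" "\<rho> \<subseteq> \<sigma>"
proof -
  obtain \<sigma> where "cofacets \<rho> = {\<sigma>}"
    using assms by (auto simp: free_ridges_def card_1_singleton_iff simp flip: cofacets_def)
  then have "\<sigma> \<in> cofacets \<rho>"
    by simp
  then show thesis
    using that unfolding cofacets_def by blast
qed

text \<open>The pseudomanifold condition allows at most two facets at a ridge, and the two given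
  ones already exhaust this bound.\<close>

lemma cofacets_shared:
  assumes \<rho>: "\<rho> \<in> faces (d - 1) \<Delta>"
    and "\<sigma> \<in> facets \<Delta>" "\<tau> \<in> facets \<Delta>" "\<sigma> \<noteq> \<tau>" "\<rho> \<subseteq> \<sigma>" "\<rho> \<subseteq> \<tau>"
  shows "cofacets \<rho> = {\<sigma>, \<tau>}" "\<rho> \<notin> free_ridges d \<Delta>"
proof -
  have "card (cofacets \<rho>) \<le> 2"
    using pseudomanifold \<rho> by (simp add: pseudomanifold_def cofacets_def)
  moreover have "{\<sigma>, \<tau>} \<subseteq> cofacets \<rho>" "finite (cofacets \<rho>)"
    using assms by (auto simp: cofacets_def)
  ultimately show "cofacets \<rho> = {\<sigma>, \<tau>}"
    using card_seteq[of "cofacets \<rho>" "{\<sigma>, \<tau>}"] \<open>\<sigma> \<noteq> \<tau>\<close> by simp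
  then show "\<rho> \<notin> free_ridges d \<Delta>"
    using \<open>\<sigma> \<noteq> \<tau>\<close> by (auto simp: free_ridges_def simp flip: cofacets_def)
qed

text \<open>Extending the ridge to an inclusion-maximal face yields a first facet; it cannot be the
  only one, because the ridge would then be free.\<close>

lemma interior_ridge_cofacets:
  assumes \<rho>: "\<rho> \<in> faces (d - 1) \<Delta>" "\<rho> \<notin> free_ridges d \<Delta>"
  obtains \<sigma> \<tau> where "\<sigma> \<in> facets \<Delta>" "\<tau> \<in> facets \<Delta>" "\<sigma> \<noteq> \<tau>" "\<rho> \<subseteq> \<sigma>" "\<rho> \<subseteq> \<tau>"
proof -
  have "\<rho> \<in> \<Delta>"
    using \<rho> by (simp add: faces_def)
  then obtain \<sigma> where "\<sigma> \<in> \<Delta>" "\<rho> \<subseteq> \<sigma>" "\<forall>b\<in>\<Delta>. \<sigma> \<subseteq> b \<longrightarrow> \<sigma> = b"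
    using finite_has_maximal2[OF finite_complex] by blast
  then have \<sigma>: "\<sigma> \<in> cofacets \<rho>"
    by (auto simp: facets_def cofacets_def)
  moreover have "cofacets \<rho> \<noteq> {\<sigma>}"
    using \<rho> by (auto simp: free_ridges_def simp flip: cofacets_def)
  ultimately obtain \<tau> where "\<tau> \<in> cofacets \<rho>" "\<sigma> \<noteq> \<tau>"
    by blast
  then show thesis
    using \<sigma> that by (auto simp: cofacets_def)
qed

text \<open>This is the coefficient at \<open>\<rho>\<close> of the boundary of the chain
  \<open>c\<close>. Real coefficients serve both linear relations among columns and the later
  normalisation of a cycle to signs.\<close>

definition ridge_sum :: "(nat set \<Rightarrow> real) \<Rightarrow> nat set \<Rightarrow> real" where
  "ridge_sum c \<rho> = (\<Sum>\<sigma>\<in>facets \<Delta>. c \<sigma> * real_of_int (bd_matrix \<rho> \<sigma>))"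

lemma ridge_sum_cofacets:
  "ridge_sum c \<rho> = (\<Sum>\<sigma>\<in>cofacets \<rho>. c \<sigma> * real_of_int (bd_matrix \<rho> \<sigma>))"
  unfolding ridge_sum_def
  by (rule sum.mono_neutral_right) (auto simp: bd_matrix_noncofacet, auto simp: cofacets_def)

text \<open>At a ridge shared by two facets the sum has two terms with coefficients +-1, so its
  vanishing forces equal absolute values; paths of adjacent facets carry this to every pair.\<close>

lemma cycle_abs_constant:
  assumes cycle: "\<And>\<rho>. \<rho> \<in> faces (d - 1) \<Delta> \<Longrightarrow> \<rho> \<notin> free_ridges d \<Delta> \<Longrightarrow> ridge_sum c \<rho> = 0"
    and "\<sigma> \<in> facets \<Delta>" "\<tau> \<in> facets \<Delta>"
  shows "\<bar>c \<sigma>\<bar> = \<bar>c \<tau>\<bar>"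
proof -
  have step: "\<bar>c \<sigma>\<bar> = \<bar>c \<tau>\<bar>" if adj: "ridge_adjacent d \<Delta> \<sigma> \<tau>" for \<sigma> \<tau>
  proof -
    obtain \<rho> where \<rho>: "\<rho> \<in> faces (d - 1) \<Delta>" "\<rho> \<subseteq> \<sigma>" "\<rho> \<subseteq> \<tau>"
      and *: "\<sigma> \<in> facets \<Delta>" "\<tau> \<in> facets \<Delta>" "\<sigma> \<noteq> \<tau>"
      using adj unfolding ridge_adjacent_def by blast
    note cof = cofacets_shared[OF \<rho>(1) * \<rho>(2,3)]
    have "c \<sigma> * real_of_int (bd_matrix \<rho> \<sigma>) + c \<tau> * real_of_int (bd_matrix \<rho> \<tau>) = 0"
      using cycle[OF \<rho>(1) cof(2)] *(3) by (simp add: ridge_sum_cofacets cof(1))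
    moreover have "bd_matrix \<rho> \<sigma> \<in> {1, - 1}" "bd_matrix \<rho> \<tau> \<in> {1, - 1}"
      using bd_matrix_cofacet[OF \<rho>(1)] cof(1) by blast+
    ultimately show ?thesis
      by auto
  qed
  have "(ridge_adjacent d \<Delta>)\<^sup>*\<^sup>* \<sigma> \<tau>"
    using pseudomanifold assms(2,3) by (simp add: pseudomanifold_def)
  then show ?thesis
    by (induction rule: rtranclp_induct) (use step in auto)
qed

text \<open>A cycle vanishes on the facet at a free ridge, hence everywhere.\<close>

lemma cycle_trivial:
  assumes "free_ridges d \<Delta> \<noteq> {}"
    and cycle: "\<And>\<rho>. \<rho> \<in> faces (d - 1) \<Delta> \<Longrightarrow> ridge_sum c \<rho> = 0"
    and "\<sigma> \<in> facets \<Delta>"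
  shows "c \<sigma> = 0"
proof -
  obtain \<rho> where \<rho>: "\<rho> \<in> free_ridges d \<Delta>"
    using assms(1) by blast
  then obtain \<tau> where \<tau>: "\<tau> \<in> facets \<Delta>" "\<rho> \<subseteq> \<tau>"
    by (rule free_ridge_cofacet)
  have ridge: "\<rho> \<in> faces (d - 1) \<Delta>"
    using \<rho> by (simp add: free_ridges_def)
  note cof = cofacets_free[OF \<rho> \<tau>]
  have "bd_matrix \<rho> \<tau> \<in> {1, - 1}"
    using bd_matrix_cofacet[OF ridge] cof by blast
  then have "c \<tau> = 0"
    using cycle[OF ridge] by (auto simp: ridge_sum_cofacets cof)
  then show ?thesis
    using cycle_abs_constant[OF cycle assms(3) \<tau>(1)] by simp
qed

end


section \<open>The polytope of the columns\<close>

context pseudomanifold_complex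
begin

text \<open>A linear relation among the columns is a chain with vanishing boundary, which a free
  ridge forces to be 0. Hence the columns are independent and the polytope is an injective image of
  the standard crosspolytope.\<close>

lemma complex_polytope_crosspolytope:
  assumes "free_ridges d \<Delta> \<noteq> {}"
  shows "\<exists>m. \<exists>Q :: (nat \<Rightarrow>\<^sub>0 real) set. is_crosspolytope (card (faces d \<Delta>)) Q \<and>
    unimodularly_equivalent (faces (d - 1) \<Delta>) (complex_polytope d \<Delta>) {1..m} Q"
proof -
  define s where "s = card (faces d \<Delta>)"
  define m where "m = card (faces (d - 1) \<Delta>)"
  let ?R = "faces (d - 1) \<Delta>"
  let ?col = "matrix_column ?R bd_matrix"
  obtain e where e: "bij_betw e {1..s} (faces d \<Delta>)"
    using ex_bij_betw_nat_finite_1[of "faces d \<Delta>"] s_def by auto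
  obtain \<gamma> where \<gamma>: "bij_betw \<gamma> ?R {1..m}"
    using finite_same_card_bij[of ?R "{1..m}"] m_def by auto
  \<comment> \<open>\<open>f\<close> sends the \<open>i\<close>-th unit vector to the
    \<open>i\<close>-th column, and \<open>g\<close> then merely numbers the ridges so that the
    target has coordinates \<open>{1..m}\<close>.\<close>
  define f where "f x = (\<Sum>i\<in>{1..s}. Poly_Mapping.lookup x i *\<^sub>R ?col (e i))" for x :: "nat \<Rightarrow>\<^sub>0 real"
  define g where "g = coord_map ?R \<gamma> (\<lambda>_. 1)"
  have lin: "linear f"
    by (rule linearI)
      (simp_all add: f_def lookup_add scaleR_left_distrib sum.distrib scaleR_right.sum)
  have f_single: "f (Poly_Mapping.single i 1) = ?col (e i)" if "i \<in> {1..s}" for i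
  proof -
    have "f (Poly_Mapping.single i 1) = (\<Sum>j\<in>{1..s}. if j = i then ?col (e j) else 0)"
      unfolding f_def by (intro sum.cong) (auto simp: lookup_single when_def)
    then show ?thesis
      using that by simp
  qed
  have "f ` standard_crosspolytope s =
      convex hull (\<Union>i\<in>{1..s}. f ` {Poly_Mapping.single i 1, - Poly_Mapping.single i 1})"
    unfolding standard_crosspolytope_def convex_hull_linear_image[OF lin] image_UN ..
  also have "(\<Union>i\<in>{1..s}. f ` {Poly_Mapping.single i 1, - Poly_Mapping.single i 1}) =
      (\<Union>i\<in>{1..s}. {?col (e i), - ?col (e i)})"
    using f_single by (intro SUP_cong) (auto simp: linear_neg[OF lin])
  also have "\<dots> = (\<Union>\<sigma>\<in>e ` {1..s}. {?col \<sigma>, - ?col \<sigma>})"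
    by simp
  also have "e ` {1..s} = faces d \<Delta>"
    using e by (simp add: bij_betw_def)
  finally have f_image: "f ` standard_crosspolytope s = complex_polytope d \<Delta>"
    by (simp add: complex_polytope_def sym_polytope_alt)
  have P: "complex_polytope d \<Delta> \<subseteq> coord_space ?R"
    unfolding complex_polytope_def by (rule sym_polytope_subset_coord_space) simp
  have inj_f: "inj_on f (coord_space {1..s})"
  proof (subst linear_inj_on_iff_eq_0[OF lin subspace_coord_space], intro ballI impI)
    fix x :: "nat \<Rightarrow>\<^sub>0 real"
    assume x: "x \<in> coord_space {1..s}" and fx: "f x = 0"
    \<comment> \<open>A vector in the kernel is read as a chain on the facets; the coordinates of
      \<open>f x\<close> are then its ridge sums.\<close>
    define c where "c \<sigma> = Poly_Mapping.lookup x (inv_into {1..s} e \<sigma>)" for \<sigma>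
    have ce: "c (e i) = Poly_Mapping.lookup x i" if "i \<in> {1..s}" for i
      using that e by (simp add: c_def bij_betw_inv_into_left)
    have "ridge_sum c \<rho> = 0" if "\<rho> \<in> ?R" for \<rho>
    proof -
      have "ridge_sum c \<rho> = (\<Sum>i\<in>{1..s}. c (e i) * real_of_int (bd_matrix \<rho> (e i)))"
        unfolding ridge_sum_def facets_eq_faces by (rule sum.reindex_bij_betw[OF e, symmetric])
      also have "\<dots> = Poly_Mapping.lookup (f x) \<rho>"
        unfolding f_def lookup_sum using ce that
        by (intro sum.cong) (simp_all add: lookup_matrix_column)
      finally show ?thesis
        by (simp add: fx)
    qed
    then have "c \<sigma> = 0" if "\<sigma> \<in> facets \<Delta>" for \<sigma>
      using cycle_trivial[OF assms] that by blast
    then have "Poly_Mapping.lookup x i = 0" if "i \<in> {1..s}" for i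
      using ce[OF that] e that by (metis bij_betwE facets_eq_faces)
    then show "x = 0"
      using x by (intro poly_mapping_eqI) (metis coord_space_iff lookup_zero)
  qed
  \<comment> \<open>The renumbering \<open>g\<close> is injective only on vectors supported on the
    ridges, so the image of \<open>f\<close> must lie there.\<close>
  have f_coord: "f ` coord_space {1..s} \<subseteq> coord_space ?R"
  proof -
    have "?col \<sigma> \<in> coord_space ?R" for \<sigma>
      by (simp add: coord_space_iff lookup_matrix_column)
    then show ?thesis
      unfolding f_def
      by (auto intro!: subspace_sum subspace_scale subspace_coord_space)
  qed
  have "inj_on (g \<circ> f) (coord_space {1..s})"
  proof (rule comp_inj_on[OF inj_f])
    show "inj_on g (f ` coord_space {1..s})"
      unfolding g_def using \<gamma> f_coord
      by (intro inj_on_subset[OF inj_on_coord_map]) (auto simp: bij_betw_def)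
  qed
  then have "is_crosspolytope s ((g \<circ> f) ` standard_crosspolytope s)"
    using is_crosspolytope_linear_image linear_compose[OF lin linear_coord_map] g_def by blast
  then have "is_crosspolytope s (g ` complex_polytope d \<Delta>)"
    by (simp add: image_comp f_image flip: f_image)
  moreover have "unimodularly_equivalent ?R (complex_polytope d \<Delta>) {1..m} (g ` complex_polytope d \<Delta>)"
    unfolding g_def by (rule unimodularly_equivalent_coord_map[OF _ \<gamma> _ P]) auto
  ultimately show ?thesis
    unfolding s_def by blast
qed

end


section \<open>The polytope of the rows\<close>

text \<open>The sum over the support extends to all of \<open>F\<close> by zero terms;
  \<open>d \<ge> 1\<close> ensures that \<open>chain_bd\<close> is the genuine boundary and not the
  zero map of degree 0.\<close>

lemma lookup_chain_bd:
  assumes "Poly_Mapping.keys c \<subseteq> F" "finite F" "d \<ge> 1"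
  shows "Poly_Mapping.lookup (chain_bd d c) \<rho> = (\<Sum>\<sigma>\<in>F. Poly_Mapping.lookup c \<sigma> * bd_matrix \<rho> \<sigma>)"
proof -
  have "Poly_Mapping.lookup (chain_bd d c) \<rho> =
      (\<Sum>\<sigma>\<in>Poly_Mapping.keys c. Poly_Mapping.lookup c \<sigma> * bd_matrix \<rho> \<sigma>)"
    using assms(3) by (simp add: chain_bd_def frag_extend_def lookup_sum bd_matrix_def)
  also have "\<dots> = (\<Sum>\<sigma>\<in>F. Poly_Mapping.lookup c \<sigma> * bd_matrix \<rho> \<sigma>)"
    using assms by (intro sum.mono_neutral_left) (simp_all add: not_in_keys_iff_lookup_eq_zero)
  finally show ?thesis .
qed

section \<open>Relative cycles, orientation signs and the whiskered graph\<close>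

context pseudomanifold_complex
begin

text \<open>Every face of the boundary complex lies in a ridge and so has at most \<open>d\<close>
  vertices. Relative \<open>d\<close>-chains are therefore ordinary \<open>d\<close>-chains.\<close>

lemma faces_boundary_complex: "faces d (boundary_complex d \<Delta>) = {}"
proof -
  have le: "card \<tau> \<le> d" if "\<rho> \<in> free_ridges d \<Delta>" "\<tau> \<subseteq> \<rho>" for \<rho> \<tau>
  proof -
    \<comment> \<open>As \<open>d \<ge> 1\<close>, the natural subtraction \<open>d - 1\<close> is
      not truncated and a ridge has exactly \<open>d\<close> vertices.\<close>
    have "\<rho> \<in> \<Delta>" "card \<rho> = d"
      using that dim_pos by (auto simp: free_ridges_def faces_def)
    then show ?thesis
      using card_mono[OF finite_face that(2)] by simp
  qed
  have "\<not> card \<tau> = d + 1" if \<tau>: "\<tau> \<in> boundary_complex d \<Delta>" for \<tau>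
  proof -
    obtain \<rho> where "\<rho> \<in> free_ridges d \<Delta>" "\<tau> \<subseteq> \<rho>"
      using \<tau> unfolding boundary_complex_def by blast
    then have "card \<tau> \<le> d"
      by (rule le)
    then show ?thesis
      by simp
  qed
  then show ?thesis
    by (auto simp: faces_def)
qed

text \<open>A subset of a free ridge with as many vertices is that ridge. Thus the boundary of a
  relative cycle is supported on free ridges.\<close>

lemma ridges_boundary_complex: "faces (d - 1) (boundary_complex d \<Delta>) \<subseteq> free_ridges d \<Delta>"
proof
  fix \<tau> assume "\<tau> \<in> faces (d - 1) (boundary_complex d \<Delta>)"
  then obtain \<rho> where \<rho>: "\<rho> \<in> free_ridges d \<Delta>" "\<tau> \<subseteq> \<rho>" and card: "card \<tau> = d - 1 + 1"
    by (auto simp: faces_def boundary_complex_def)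
  moreover have "finite \<rho>" "card \<rho> = d - 1 + 1"
    using \<rho> by (auto simp: free_ridges_def faces_def finite_face)
  ultimately have "\<tau> = \<rho>"
    by (simp add: card_subset_eq)
  then show "\<tau> \<in> free_ridges d \<Delta>"
    using \<rho> by simp
qed

text \<open>The relative homology is isomorphic to the integers, hence infinite, so the group of
  relative cycles contains more than the zero coset.\<close>

lemma orientable_nonzero_cycle:
  assumes "orientable d \<Delta>"
  obtains c where "Poly_Mapping.keys c \<subseteq> facets \<Delta>" "c \<noteq> 0"
    "\<And>\<rho>. \<rho> \<notin> free_ridges d \<Delta> \<Longrightarrow> Poly_Mapping.lookup (chain_bd d c) \<rho> = 0"
proof -
  let ?\<Gamma> = "boundary_complex d \<Delta>"
  let ?C = "rel_chain_group d \<Delta> ?\<Gamma>" and ?C' = "rel_chain_group (d - 1) \<Delta> ?\<Gamma>"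
  let ?K = "kernel ?C ?C' (rel_bd d \<Delta> ?\<Gamma>)"
  obtain h where "h \<in> iso (rel_homology d \<Delta> ?\<Gamma>) integer_group"
    using assms unfolding orientable_def is_iso_def by blast
  then have "bij_betw h (carrier (rel_homology d \<Delta> ?\<Gamma>)) (UNIV :: int set)"
    by (simp add: iso_def)
  then have inf: "infinite (carrier (rel_homology d \<Delta> ?\<Gamma>))"
    using bij_betw_finite infinite_UNIV_int by blast
  have trivial: "carrier (simp_chain_group d ?\<Gamma>) = {0}"
    by (auto simp: simp_chain_group_def faces_boundary_complex free_Abelian_group_def)
  \<comment> \<open>The subgroup divided out is trivial in degree \<open>d\<close>, so each coset is
    a singleton and determines a chain.\<close>
  have cosets: "carrier ?C = {{c} | c. Poly_Mapping.keys c \<subseteq> facets \<Delta>}"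
    unfolding rel_chain_group_def FactGroup_def RCOSETS_def r_coset_def trivial
    by (auto simp: simp_chain_group_def free_Abelian_group_def facets_eq_faces)
  \<comment> \<open>Homology classes are cosets of elements of \<open>?K\<close>; a kernel
    consisting of the zero coset alone would leave finitely many.\<close>
  have K_ne: "\<exists>X\<in>?K. X \<noteq> {0}"
  proof (rule ccontr)
    assume "\<not> ?thesis"
    then have "?K \<subseteq> {{0}}"
      by blast
    then have "finite ?K"
      using finite_subset by blast
    then have "finite (carrier (rel_homology d \<Delta> ?\<Gamma>))"
      unfolding rel_homology_def FactGroup_def RCOSETS_def by simp
    then show False
      using inf by simp
  qed
  then obtain c where c: "{c} \<in> ?K" "c \<noteq> 0" "Poly_Mapping.keys c \<subseteq> facets \<Delta>"
    using cosets by (auto simp: kernel_def)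
  \<comment> \<open>The identity of the quotient \<open>?C'\<close> is the chain group of the
    boundary complex itself.\<close>
  have "rel_bd d \<Delta> ?\<Gamma> {c} = carrier (simp_chain_group (d - 1) ?\<Gamma>)"
    using c(1) by (simp add: kernel_def rel_chain_group_def FactGroup_def)
  \<comment> \<open>Adding the zero chain shows that the coset contains its representative.\<close>
  moreover have "chain_bd d c \<in> rel_bd d \<Delta> ?\<Gamma> {c}"
    unfolding rel_bd_def set_mult_def simp_chain_group_def
    by (auto simp: intro!: exI[of _ "0 :: nat set \<Rightarrow>\<^sub>0 int"])
  ultimately have "Poly_Mapping.keys (chain_bd d c) \<subseteq> faces (d - 1) ?\<Gamma>"
    by (simp add: simp_chain_group_def)
  then have "Poly_Mapping.lookup (chain_bd d c) \<rho> = 0" if "\<rho> \<notin> free_ridges d \<Delta>" for \<rho>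
    using that ridges_boundary_complex by (metis in_keys_iff subsetD)
  then show thesis
    using that c by blast
qed

text \<open>Dividing a nonzero relative cycle by the common absolute value of its coefficients
  leaves signs and keeps the cycle condition.\<close>

lemma orientable_signs:
  assumes "orientable d \<Delta>"
  obtains \<epsilon> :: "nat set \<Rightarrow> real" where "\<And>\<sigma>. \<sigma> \<in> facets \<Delta> \<Longrightarrow> \<epsilon> \<sigma> \<in> {1, - 1}"
    "\<And>\<rho>. \<rho> \<notin> free_ridges d \<Delta> \<Longrightarrow> ridge_sum \<epsilon> \<rho> = 0"
proof -
  obtain c where c: "Poly_Mapping.keys c \<subseteq> facets \<Delta>" "c \<noteq> 0"
    "\<And>\<rho>. \<rho> \<notin> free_ridges d \<Delta> \<Longrightarrow> Poly_Mapping.lookup (chain_bd d c) \<rho> = 0"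
    using orientable_nonzero_cycle[OF assms] by blast
  define z where "z \<sigma> = real_of_int (Poly_Mapping.lookup c \<sigma>)" for \<sigma>
  have cycle: "ridge_sum z \<rho> = 0" if "\<rho> \<notin> free_ridges d \<Delta>" for \<rho>
    using c(3)[OF that] unfolding lookup_chain_bd[OF c(1) finite_facets dim_pos]
    unfolding ridge_sum_def z_def
    by (metis (mono_tags, lifting) of_int_0 of_int_mult of_int_sum sum.cong)
  \<comment> \<open>A facet in the support of \<open>c\<close> makes the common absolute value
    nonzero.\<close>
  obtain \<sigma>0 where "\<sigma>0 \<in> Poly_Mapping.keys c"
    using c(2) by (metis all_not_in_conv keys_eq_empty)
  then have \<sigma>0: "\<sigma>0 \<in> facets \<Delta>" "z \<sigma>0 \<noteq> 0"
    using c(1) by (auto simp: z_def simp flip: lookup_not_eq_zero_eq_in_keys)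
  have abs: "\<bar>z \<sigma>\<bar> = \<bar>z \<sigma>0\<bar>" if "\<sigma> \<in> facets \<Delta>" for \<sigma>
    using cycle_abs_constant[OF cycle that \<sigma>0(1)] .
  show thesis
  proof (rule that[of "\<lambda>\<sigma>. z \<sigma> / \<bar>z \<sigma>0\<bar>"])
    show "z \<sigma> / \<bar>z \<sigma>0\<bar> \<in> {1, - 1}" if "\<sigma> \<in> facets \<Delta>" for \<sigma>
      using abs[OF that] \<sigma>0(2) by (auto simp: field_simps abs_if split: if_splits)
    show "ridge_sum (\<lambda>\<sigma>. z \<sigma> / \<bar>z \<sigma>0\<bar>) \<rho> = 0" if "\<rho> \<notin> free_ridges d \<Delta>" for \<rho>
    proof -
      have "ridge_sum (\<lambda>\<sigma>. z \<sigma> / \<bar>z \<sigma>0\<bar>) \<rho> = ridge_sum z \<rho> / \<bar>z \<sigma>0\<bar>"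
        unfolding ridge_sum_def by (simp add: sum_divide_distrib)
      then show ?thesis
        using cycle[OF that] by simp
    qed
  qed
qed

text \<open>Only one facet contains the ridge, so its row has a single nonzero entry, and
  \<open>k\<close> is that entry after the sign change.\<close>

lemma signed_row_free:
  fixes \<epsilon> :: "nat set \<Rightarrow> real"
  assumes \<epsilon>: "\<And>\<sigma>. \<sigma> \<in> facets \<Delta> \<Longrightarrow> \<epsilon> \<sigma> \<in> {1, - 1}"
    and \<rho>: "\<rho> \<in> free_ridges d \<Delta>" and \<sigma>: "\<sigma> \<in> facets \<Delta>" "\<rho> \<subseteq> \<sigma>"
  shows "\<exists>k\<in>{1, - 1}. \<forall>\<tau>\<in>facets \<Delta>. \<epsilon> \<tau> * real_of_int (bd_matrix \<rho> \<tau>) = (if \<tau> = \<sigma> then k else 0)"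
proof -
  note cof = cofacets_free[OF \<rho> \<sigma>]
  have "bd_matrix \<rho> \<sigma> \<in> {1, - 1}"
    using bd_matrix_cofacet[of \<rho> \<sigma>] cof \<rho> by (auto simp: free_ridges_def)
  then show ?thesis
    using \<epsilon>[OF \<sigma>(1)] cof bd_matrix_noncofacet[of _ \<rho>]
    by (intro bexI[of _ "\<epsilon> \<sigma> * real_of_int (bd_matrix \<rho> \<sigma>)"]) auto
qed

text \<open>The row has two nonzero entries, and after the sign change they add up to 0 because the
  signs form a relative cycle.\<close>

lemma signed_row_interior:
  fixes \<epsilon> :: "nat set \<Rightarrow> real"
  assumes \<epsilon>: "\<And>\<sigma>. \<sigma> \<in> facets \<Delta> \<Longrightarrow> \<epsilon> \<sigma> \<in> {1, - 1}"
    and cycle: "\<And>\<rho>. \<rho> \<notin> free_ridges d \<Delta> \<Longrightarrow> ridge_sum \<epsilon> \<rho> = 0"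
    and \<rho>: "\<rho> \<in> faces (d - 1) \<Delta>"
    and *: "\<sigma> \<in> facets \<Delta>" "\<tau> \<in> facets \<Delta>" "\<sigma> \<noteq> \<tau>" "\<rho> \<subseteq> \<sigma>" "\<rho> \<subseteq> \<tau>"
  shows "\<exists>k\<in>{1, - 1}. \<forall>\<phi>\<in>facets \<Delta>. \<epsilon> \<phi> * real_of_int (bd_matrix \<rho> \<phi>) =
    (if \<phi> = \<sigma> then k else if \<phi> = \<tau> then - k else 0)"
proof -
  note cof = cofacets_shared[OF \<rho> *]
  have "\<epsilon> \<sigma> * real_of_int (bd_matrix \<rho> \<sigma>) + \<epsilon> \<tau> * real_of_int (bd_matrix \<rho> \<tau>) = 0"
    using cycle[OF cof(2)] *(3) by (simp add: ridge_sum_cofacets cof(1))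
  moreover have "bd_matrix \<rho> \<sigma> \<in> {1, - 1}"
    using bd_matrix_cofacet[OF \<rho>] cof(1) by blast
  ultimately show ?thesis
    using \<epsilon>[OF *(1)] cof bd_matrix_noncofacet[of _ \<rho>]
    by (intro bexI[of _ "\<epsilon> \<sigma> * real_of_int (bd_matrix \<rho> \<sigma>)"]) auto
qed

text \<open>Flipping the facet coordinates by the orientation signs turns the rows of the boundary
  matrix, up to sign, into the projected incidence columns: shared ridges match edges of
  \<open>G\<close>, free ridges match whiskers.\<close>

lemma complex_copolytope_whiskering:
  fixes G :: "nat set ugraph"
  assumes "orientable d \<Delta>"
    and G: "G = facet_ridge_graph d \<Delta>"
    and A: "A = {\<sigma> \<in> gverts G. \<exists>\<rho>\<in>free_ridges d \<Delta>. \<rho> \<subseteq> \<sigma>}"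
    and D: "orientation_of (whiskering G A) D"
  shows "unimodularly_equivalent (faces d \<Delta>) (complex_copolytope d \<Delta>) (Inl ` gverts G)
    (coord_projection (Inl ` gverts G) ` graph_polytope (whiskering G A) D)"
proof -
  obtain \<epsilon> :: "nat set \<Rightarrow> real" where \<epsilon>: "\<And>\<sigma>. \<sigma> \<in> facets \<Delta> \<Longrightarrow> \<epsilon> \<sigma> \<in> {1, - 1}"
    and cycle: "\<And>\<rho>. \<rho> \<notin> free_ridges d \<Delta> \<Longrightarrow> ridge_sum \<epsilon> \<rho> = 0"
    using orientable_signs[OF assms(1)] by blast
  let ?R = "faces (d - 1) \<Delta>" and ?W = "Inl ` facets \<Delta> :: (nat set + nat set) set"
  let ?H = "whiskering G A"
  define L where "L = coord_map (facets \<Delta>) (Inl :: _ \<Rightarrow> nat set + nat set) \<epsilon>"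
  define \<pi> where "\<pi> = coord_map ?W (\<lambda>v. v) (\<lambda>_. 1)"
  \<comment> \<open>\<open>r\<close> lists the generators of one polytope after the sign change,
    \<open>q\<close> those of the other after the projection.\<close>
  define r where "r \<rho> = L (matrix_column (facets \<Delta>) (\<lambda>\<sigma> \<tau>. bd_matrix \<tau> \<sigma>) \<rho>)" for \<rho>
  define q where "q a = \<pi> (matrix_column (gverts ?H) incidence_matrix a)" for a
  have verts: "gverts G = facets \<Delta>"
    by (simp add: G facet_ridge_graph_def)
  have proj: "coord_projection ?W = \<pi>"
    by (simp add: fun_eq_iff coord_projection_def \<pi>_def coord_map_def)
  have finH: "finite (gverts ?H)"
    by (simp add: whiskering_def A verts)
  have r_in: "Poly_Mapping.lookup (r \<rho>) (Inl \<sigma>) = \<epsilon> \<sigma> * real_of_int (bd_matrix \<rho> \<sigma>)"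
    if "\<sigma> \<in> facets \<Delta>" for \<rho> \<sigma>
    using that by (simp add: r_def L_def lookup_coord_map lookup_matrix_column)
  have r_out: "Poly_Mapping.lookup (r \<rho>) w = 0" if "w \<notin> ?W" for \<rho> w
    using that by (simp add: r_def L_def lookup_coord_map_notin)
  have q_in: "Poly_Mapping.lookup (q a) (Inl \<sigma>) = real_of_int (incidence_matrix (Inl \<sigma>) a)"
    if "\<sigma> \<in> facets \<Delta>" for a \<sigma>
  proof -
    have "Poly_Mapping.lookup (q a) (Inl \<sigma>) =
        Poly_Mapping.lookup (matrix_column (gverts ?H) incidence_matrix a) (Inl \<sigma>)"
      using that lookup_coord_map[of ?W "\<lambda>v. v" "Inl \<sigma>" "\<lambda>_. 1"] by (simp add: q_def \<pi>_def)
    then show ?thesis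
      using that finH by (simp add: lookup_matrix_column whiskering_def verts)
  qed
  have q_out: "Poly_Mapping.lookup (q a) w = 0" if "w \<notin> ?W" for a w
    using that by (simp add: q_def \<pi>_def lookup_coord_map_notin)
  have eqI: "x = y"
    if "\<And>\<sigma>. \<sigma> \<in> facets \<Delta> \<Longrightarrow> Poly_Mapping.lookup x (Inl \<sigma>) = Poly_Mapping.lookup y (Inl \<sigma>)"
      "\<And>w. w \<notin> ?W \<Longrightarrow> Poly_Mapping.lookup x w = 0" "\<And>w. w \<notin> ?W \<Longrightarrow> Poly_Mapping.lookup y w = 0"
    for x y :: "(nat set + nat set) \<Rightarrow>\<^sub>0 real"
    using that by (intro poly_mapping_eqI) (metis imageE)
  have free: "r \<rho> \<in> {q a, - q a}"
    if \<rho>: "\<rho> \<in> free_ridges d \<Delta>" and \<sigma>: "\<sigma> \<in> facets \<Delta>" "\<rho> \<subseteq> \<sigma>"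
      and a: "{fst a, snd a} = {Inl \<sigma>, Inr \<sigma>}" for \<rho> \<sigma> a
  proof -
    obtain k where k: "k \<in> {1, - 1}"
      "\<forall>\<tau>\<in>facets \<Delta>. \<epsilon> \<tau> * real_of_int (bd_matrix \<rho> \<tau>) = (if \<tau> = \<sigma> then k else 0)"
      using signed_row_free[OF \<epsilon> \<rho> \<sigma>] by (rule bexE)
    \<comment> \<open>The projection drops the leaf coordinate, so either direction of a whisker
      leaves a signed unit vector.\<close>
    have "a = (Inl \<sigma>, Inr \<sigma>) \<or> a = (Inr \<sigma>, Inl \<sigma>)"
      using a by (auto simp: doubleton_eq_iff prod_eq_iff)
    then have "(\<forall>\<tau>\<in>facets \<Delta>. real_of_int (incidence_matrix (Inl \<tau>) a) = (if \<tau> = \<sigma> then k else 0)) \<or>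
        (\<forall>\<tau>\<in>facets \<Delta>. real_of_int (incidence_matrix (Inl \<tau>) a) = (if \<tau> = \<sigma> then - k else 0))"
      using k(1) by (auto simp: incidence_matrix_def)
    then have "r \<rho> = q a \<or> r \<rho> = - q a"
    proof
      assume "\<forall>\<tau>\<in>facets \<Delta>. real_of_int (incidence_matrix (Inl \<tau>) a) = (if \<tau> = \<sigma> then k else 0)"
      then have "r \<rho> = q a"
        by (intro eqI) (simp_all add: r_in q_in r_out q_out k(2))
      then show ?thesis ..
    next
      assume "\<forall>\<tau>\<in>facets \<Delta>. real_of_int (incidence_matrix (Inl \<tau>) a) = (if \<tau> = \<sigma> then - k else 0)"
      then have "r \<rho> = - q a"
        by (intro eqI) (simp_all add: r_in q_in r_out q_out k(2))
      then show ?thesis ..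
    qed
    then show ?thesis by simp
  qed
  have interior: "r \<rho> \<in> {q a, - q a}"
    if \<rho>: "\<rho> \<in> ?R" and *: "\<sigma> \<in> facets \<Delta>" "\<tau> \<in> facets \<Delta>" "\<sigma> \<noteq> \<tau>" "\<rho> \<subseteq> \<sigma>" "\<rho> \<subseteq> \<tau>"
      and a: "{fst a, snd a} = {Inl \<sigma>, Inl \<tau>}" for \<rho> \<sigma> \<tau> a
  proof -
    obtain k where k: "k \<in> {1, - 1}"
      "\<forall>\<phi>\<in>facets \<Delta>. \<epsilon> \<phi> * real_of_int (bd_matrix \<rho> \<phi>) =
        (if \<phi> = \<sigma> then k else if \<phi> = \<tau> then - k else 0)"
      using signed_row_interior[OF \<epsilon> cycle \<rho> *] by (rule bexE)
    \<comment> \<open>Reversing the arc changes only the overall sign of its column, which the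
      antipodal pair absorbs.\<close>
    have arc: "a = (Inl \<sigma>, Inl \<tau>) \<or> a = (Inl \<tau>, Inl \<sigma>)"
      using a by (auto simp: doubleton_eq_iff prod_eq_iff)
    have inc:
      "real_of_int (incidence_matrix (Inl \<phi>) (Inl \<sigma>, Inl \<tau>)) =
        (if \<phi> = \<sigma> then - 1 else if \<phi> = \<tau> then 1 else 0)"
      "real_of_int (incidence_matrix (Inl \<phi>) (Inl \<tau>, Inl \<sigma>)) =
        (if \<phi> = \<sigma> then 1 else if \<phi> = \<tau> then - 1 else 0)" for \<phi>
      using *(3) by (simp_all add: incidence_matrix_def)
    have "(\<forall>\<phi>\<in>facets \<Delta>. real_of_int (incidence_matrix (Inl \<phi>) a) =
          (if \<phi> = \<sigma> then k else if \<phi> = \<tau> then - k else 0)) \<or>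
        (\<forall>\<phi>\<in>facets \<Delta>. real_of_int (incidence_matrix (Inl \<phi>) a) =
          (if \<phi> = \<sigma> then - k else if \<phi> = \<tau> then k else 0))"
      using arc k(1) by (elim disjE insertE emptyE) (simp_all add: inc)
    then have "r \<rho> = q a \<or> r \<rho> = - q a"
    proof
      assume "\<forall>\<phi>\<in>facets \<Delta>. real_of_int (incidence_matrix (Inl \<phi>) a) =
          (if \<phi> = \<sigma> then k else if \<phi> = \<tau> then - k else 0)"
      then have "r \<rho> = q a"
        by (intro eqI) (simp_all add: r_in q_in r_out q_out k(2))
      then show ?thesis ..
    next
      assume "\<forall>\<phi>\<in>facets \<Delta>. real_of_int (incidence_matrix (Inl \<phi>) a) =
          (if \<phi> = \<sigma> then - k else if \<phi> = \<tau> then k else 0)"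
      then have "r \<rho> = - q a"
        by (intro eqI) (simp_all add: r_in q_in r_out q_out k(2))
      then show ?thesis ..
    qed
    then show ?thesis by simp
  qed
  have edges: "gedges ?H = {{Inl \<sigma>, Inl \<tau>} | \<sigma> \<tau>. ridge_adjacent d \<Delta> \<sigma> \<tau>} \<union> {{Inl \<sigma>, Inr \<sigma>} | \<sigma>. \<sigma> \<in> A}"
    by (auto simp: whiskering_def G facet_ridge_graph_def image_def)
  have image_D: "(\<lambda>a. {fst a, snd a}) ` D = gedges ?H"
    using D by (simp add: orientation_of_def bij_betw_def case_prod_beta)
  \<comment> \<open>Each ridge yields an arc with the same generator up to sign; \<open>arcs\<close>
    below is the converse.\<close>
  have rows: "\<exists>a\<in>D. r \<rho> \<in> {q a, - q a}" if \<rho>: "\<rho> \<in> ?R" for \<rho>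
  proof (cases "\<rho> \<in> free_ridges d \<Delta>")
    case True
    then obtain \<sigma> where \<sigma>: "\<sigma> \<in> facets \<Delta>" "\<rho> \<subseteq> \<sigma>"
      by (rule free_ridge_cofacet)
    then have "{Inl \<sigma>, Inr \<sigma>} \<in> gedges ?H"
      unfolding edges using True by (auto simp: A verts)
    then obtain a where "a \<in> D" "{fst a, snd a} = {Inl \<sigma>, Inr \<sigma>}"
      unfolding image_D[symmetric] by auto
    then show ?thesis
      using free[OF True \<sigma>] by blast
  next
    case False
    then obtain \<sigma> \<tau> where *: "\<sigma> \<in> facets \<Delta>" "\<tau> \<in> facets \<Delta>" "\<sigma> \<noteq> \<tau>" "\<rho> \<subseteq> \<sigma>" "\<rho> \<subseteq> \<tau>"
      using interior_ridge_cofacets[OF \<rho>] by blast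
    then have "ridge_adjacent d \<Delta> \<sigma> \<tau>"
      using \<rho> by (auto simp: ridge_adjacent_def)
    then have "{Inl \<sigma>, Inl \<tau>} \<in> gedges ?H"
      by (auto simp: edges)
    then obtain a where "a \<in> D" "{fst a, snd a} = {Inl \<sigma>, Inl \<tau>}"
      unfolding image_D[symmetric] by auto
    then show ?thesis
      using interior[OF \<rho> *] by blast
  qed
  have arcs: "\<exists>\<rho>\<in>?R. r \<rho> \<in> {q a, - q a}" if "a \<in> D" for a
  proof -
    have "{fst a, snd a} \<in> gedges ?H"
      using that image_D by blast
    then consider \<sigma> \<tau> where "{fst a, snd a} = {Inl \<sigma>, Inl \<tau>}" "ridge_adjacent d \<Delta> \<sigma> \<tau>"
      | \<sigma> where "{fst a, snd a} = {Inl \<sigma>, Inr \<sigma>}" "\<sigma> \<in> A"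
      unfolding edges by blast
    then show ?thesis
    proof cases
      case 1
      then show ?thesis
        using interior unfolding ridge_adjacent_def by blast
    next
      case 2
      then obtain \<rho> where "\<rho> \<in> free_ridges d \<Delta>" "\<sigma> \<in> facets \<Delta>" "\<rho> \<subseteq> \<sigma>"
        by (auto simp: A verts)
      then show ?thesis
        using free 2(1) by (metis (no_types, lifting) free_ridges_def mem_Collect_eq)
    qed
  qed
  \<comment> \<open>The correspondence need not be injective: several free ridges of one facet share
    a whisker. Hence unions of antipodal pairs are compared rather than indexed families.\<close>
  have "(\<Union>\<rho>\<in>?R. {r \<rho>, - r \<rho>}) = (\<Union>a\<in>D. {q a, - q a})"
  proof (intro equalityI UN_least)
    fix \<rho> assume "\<rho> \<in> ?R"
    then obtain a where a: "a \<in> D" "r \<rho> \<in> {q a, - q a}"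
      using rows by blast
    then have "{r \<rho>, - r \<rho>} = {q a, - q a}"
      by auto
    then show "{r \<rho>, - r \<rho>} \<subseteq> (\<Union>a\<in>D. {q a, - q a})"
      using UN_upper[OF a(1), of "\<lambda>a. {q a, - q a}"] by (simp only:)
  next
    fix a assume "a \<in> D"
    then obtain \<rho> where \<rho>: "\<rho> \<in> ?R" "r \<rho> \<in> {q a, - q a}"
      using arcs by blast
    then have "{q a, - q a} = {r \<rho>, - r \<rho>}"
      by auto
    then show "{q a, - q a} \<subseteq> (\<Union>\<rho>\<in>?R. {r \<rho>, - r \<rho>})"
      using UN_upper[OF \<rho>(1), of "\<lambda>\<rho>. {r \<rho>, - r \<rho>}"] by (simp only:)
  qed
  then have "L ` complex_copolytope d \<Delta> = coord_projection ?W ` graph_polytope ?H D"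
    unfolding complex_copolytope_def graph_polytope_def proj facets_eq_faces[symmetric]
      r_def q_def L_def \<pi>_def linear_image_sym_polytope[OF linear_coord_map]
    by simp
  moreover have "unimodularly_equivalent (facets \<Delta>) (complex_copolytope d \<Delta>) ?W
      (L ` complex_copolytope d \<Delta>)"
    unfolding L_def
  proof (rule unimodularly_equivalent_coord_map)
    show "complex_copolytope d \<Delta> \<subseteq> coord_space (facets \<Delta>)"
      unfolding complex_copolytope_def facets_eq_faces
      by (rule sym_polytope_subset_coord_space) simp
  qed (use \<epsilon> in \<open>auto simp: bij_betw_def\<close>)
  ultimately show ?thesis
    by (simp add: verts flip: facets_eq_faces)
qed

end

theorem theorem8p5:
  fixes n d s :: nat
    and \<Delta> :: "nat set set"
    and G :: "nat set ugraph"
    and A :: "nat set set"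
  assumes "d \<ge> 1"
    and "abstract_simplicial_complex n \<Delta>"
    and "pseudomanifold d \<Delta>"
    and "boundary_complex d \<Delta> \<noteq> {}"
    and "orientable d \<Delta>"
    and "s = card (faces d \<Delta>)"
    and "G = facet_ridge_graph d \<Delta>"
    and "A = {\<sigma> \<in> gverts G. \<exists>\<rho>\<in>free_ridges d \<Delta>. \<rho> \<subseteq> \<sigma>}"
  shows
    "(\<exists>m. \<exists>Q :: (nat \<Rightarrow>\<^sub>0 real) set.
        is_crosspolytope s Q \<and>
        unimodularly_equivalent (faces (d - 1) \<Delta>) (complex_polytope d \<Delta>) {1..m} Q) \<and>
     (\<forall>D. orientation_of (whiskering G A) D \<longrightarrow>
        unimodularly_equivalent
          (faces d \<Delta>) (complex_copolytope d \<Delta>)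
          (Inl ` gverts G)
          (coord_projection (Inl ` gverts G) ` graph_polytope (whiskering G A) D))"
proof -
  interpret pseudomanifold_complex n d \<Delta>
    using assms(1-3) by unfold_locales
  \<comment> \<open>Every member of the boundary complex is contained in a free ridge, so one
    exists.\<close>
  have "free_ridges d \<Delta> \<noteq> {}"
    using assms(4) by (auto simp: boundary_complex_def)
  then show ?thesis
    using complex_polytope_crosspolytope complex_copolytope_whiskering[OF assms(5,7,8)] assms(6)
    by blast
qed

end
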